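(* A class of ordered graphs has bounded twin-width if and only if it has bounded merge-width.
   Context: An ordered graph is a finite structure $G=(V,E,<)$ where $(V,E)$ is a simple undirected graph (with $E$ viewed as a symmetric irreflexive binary relation) and $<$ is a strict total order on $V$. Twin-width of ordered graphs. Two disjoint vertex sets $A,B\subseteq V$ are homogeneous in $G$ if for each relation $S\in\{E,<\}$, either all pairs $(a,b)\in A\times B$ belong to $S$, or none does. A contraction sequence of $G$ is a sequence of partitions of $V$ starting with the partition into singletons, ending with the partition with one part, where each next partition is obtained by merging two parts into one. The red graph of a partition $\mathcal P$ has vertex set $\mathcal P$ and edges connecting the pairs of distinct parts that are not homogeneous. The twin-width of $G$ is the least $d$ such that $G$ admits a contraction sequence in which the red graph of every partition has maximum degree at most $d$. A class has bounded twin-width if the twin-width of its members is bounded by a constant. Merge-width of ordered graphs. A merge sequence of $G$ is a sequence $(\mathcal P_1,R_1),\dots,(\mathcal P_m,R_m)$ such that: $\mathcal P_1,\dots,\mathcal P_m$ are partitions of $V$, with $\mathcal P_1$ the partition into singletons, $\mathcal P_m$ having one part, and each $\mathcal P_t$ coarser than or equal to $\mathcal P_{t-1}$; $R_1\subseteq\dots\subseteq R_m\subseteq\binom V2$; and for all $t$, all $A,B\in\mathcal P_t$ (possibly $A=B$) and each $S\in\{E,<\}$, either all or none of the pairs $(a,b)\in A\times B$ with $a\neq b$ and $\{a,b\}\notin R_t$ belong to $S$. Its radius-$r$ width is the maximum, over $t=2,\dots,m$ and $v\in V$, of the number of parts of $\mathcal P_{t-1}$ containing a vertex reachable from $v$ by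 a path of length at most $r$ in the graph $(V,R_t)$. The radius-$r$ merge-width of $G$ is the least radius-$r$ width of a merge sequence of $G$. A class has bounded merge-width if for every $r\in\mathbb N$ the radius-$r$ merge-width of its members is bounded by a constant. *)

theory Defs
  imports "HOL-Library.Disjoint_Sets" "HOL-Library.Ramsey"
begin

record 'a ograph =
  verts :: "'a set"
  edges :: "'a rel"
  lt :: "'a rel"

definition ordered_graph :: "'a ograph \<Rightarrow> bool" where
  "ordered_graph G \<longleftrightarrow>
     finite (verts G) \<and>
     edges G \<subseteq> verts G \<times> verts G \<and> sym (edges G) \<and> irrefl (edges G) \<and>
     lt G \<subseteq> verts G \<times> verts G \<and> strict_linear_order_on (verts G) (lt G)"

definition singletons :: "'a set \<Rightarrow> 'a set set" where
  "singletons V = (\<lambda>v. {v}) ` V"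

text \<open>Twin-width. Homogeneity is meant for disjoint sets; for these it is symmetric in the
  two arguments, so the red graph below is undirected.\<close>

definition homogeneous :: "'a ograph \<Rightarrow> 'a set \<Rightarrow> 'a set \<Rightarrow> bool" where
  "homogeneous G A B \<longleftrightarrow>
     (\<forall>S \<in> {edges G, lt G}.
        (\<forall>a\<in>A. \<forall>b\<in>B. (a, b) \<in> S) \<or> (\<forall>a\<in>A. \<forall>b\<in>B. (a, b) \<notin> S))"

definition red_degree :: "'a ograph \<Rightarrow> 'a set set \<Rightarrow> 'a set \<Rightarrow> nat" where
  "red_degree G P A = card {B \<in> P. B \<noteq> A \<and> \<not> homogeneous G A B}"

definition merges_two_parts :: "'a set set \<Rightarrow> 'a set set \<Rightarrow> bool" where
  "merges_two_parts P Q \<longleftrightarrow>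
     (\<exists>A\<in>P. \<exists>B\<in>P. A \<noteq> B \<and> Q = insert (A \<union> B) (P - {A, B}))"

text \<open>The last partition has exactly one part whenever the graph has a vertex; asking for at
  most one part makes the definitions meaningful for the graph without vertices too, whose only
  partition is empty. The same convention is used for merge sequences.\<close>

definition contraction_sequence :: "'a ograph \<Rightarrow> 'a set set list \<Rightarrow> bool" where
  "contraction_sequence G Ps \<longleftrightarrow>
     Ps \<noteq> [] \<and> (\<forall>P \<in> set Ps. partition_on (verts G) P) \<and>
     hd Ps = singletons (verts G) \<and> card (last Ps) \<le> 1 \<and>
     successively merges_two_parts Ps"

definition twin_width :: "'a ograph \<Rightarrow> nat" where
  "twin_width G = (LEAST d. \<exists>Ps. contraction_sequence G Ps \<and>
     (\<forall>P \<in> set Ps. \<forall>A \<in> P. red_degree G P A \<le> d))"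

definition bounded_twin_width :: "'a ograph set \<Rightarrow> bool" where
  "bounded_twin_width C \<longleftrightarrow> (\<exists>c. \<forall>G \<in> C. twin_width G \<le> c)"

text \<open>Merge-width. Elements of \<open>R\<close> are unordered pairs, i.e. two-element sets. In the
  following definition \<open>A = B\<close> is allowed.\<close>

definition homogeneous_outside ::
    "'a ograph \<Rightarrow> 'a set set \<Rightarrow> 'a set \<Rightarrow> 'a set \<Rightarrow> bool" where
  "homogeneous_outside G R A B \<longleftrightarrow>
     (\<forall>S \<in> {edges G, lt G}.
        (\<forall>a\<in>A. \<forall>b\<in>B. a \<noteq> b \<and> {a, b} \<notin> R \<longrightarrow> (a, b) \<in> S) \<or>
        (\<forall>a\<in>A. \<forall>b\<in>B. a \<noteq> b \<and> {a, b} \<notin> R \<longrightarrow> (a, b) \<notin> S))"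

definition merge_sequence :: "'a ograph \<Rightarrow> ('a set set \<times> 'a set set) list \<Rightarrow> bool" where
  "merge_sequence G ms \<longleftrightarrow>
     ms \<noteq> [] \<and>
     (\<forall>(P, R) \<in> set ms. partition_on (verts G) P \<and> R \<subseteq> nsets (verts G) 2 \<and>
        (\<forall>A\<in>P. \<forall>B\<in>P. homogeneous_outside G R A B)) \<and>
     fst (hd ms) = singletons (verts G) \<and> card (fst (last ms)) \<le> 1 \<and>
     successively (\<lambda>(P, R) (P', R'). refines (verts G) P P' \<and> R \<subseteq> R') ms"

text \<open>The length of a path is its number of edges, one less than its number of vertices.\<close>

definition path_between :: "'a set set \<Rightarrow> 'a \<Rightarrow> 'a list \<Rightarrow> 'a \<Rightarrow> bool" where
  "path_between R v p w \<longleftrightarrow>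
     p \<noteq> [] \<and> hd p = v \<and> last p = w \<and> distinct p \<and> successively (\<lambda>x y. {x, y} \<in> R) p"

definition reachable_within :: "'a set set \<Rightarrow> nat \<Rightarrow> 'a \<Rightarrow> 'a \<Rightarrow> bool" where
  "reachable_within R r v w \<longleftrightarrow> (\<exists>p. path_between R v p w \<and> length p - 1 \<le> r)"

text \<open>List positions start at 0, hence \<open>t\<close> starts at 1: \<open>t\<close> runs over all entries
  having a predecessor. For sequences with a single entry the supremum over the empty set is
  \<open>0 :: nat\<close>; otherwise it is a maximum over a finite set. Note that the parts are those of
  the partition preceding \<open>R\<^sub>t\<close>.\<close>

definition merge_sequence_width ::
    "nat \<Rightarrow> 'a ograph \<Rightarrow> ('a set set \<times> 'a set set) list \<Rightarrow> nat" where
  "merge_sequence_width r G ms =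
     (SUP (t, v) \<in> {1..<length ms} \<times> verts G.
        card {A \<in> fst (ms ! (t - 1)). \<exists>w\<in>A. reachable_within (snd (ms ! t)) r v w})"

definition merge_width :: "nat \<Rightarrow> 'a ograph \<Rightarrow> nat" where
  "merge_width r G = (LEAST k. \<exists>ms. merge_sequence G ms \<and> merge_sequence_width r G ms = k)"

definition bounded_merge_width :: "'a ograph set \<Rightarrow> bool" where
  "bounded_merge_width C \<longleftrightarrow> (\<forall>r. \<exists>c. \<forall>G \<in> C. merge_width r G \<le> c)"

end

theory Submission
  imports Defs
begin

text \<open>The two parameters bound each other for every single ordered graph \<open>G\<close>.

  Merge-width bounds twin-width: \<open>twin_width G \<le> merge_width 2 G\<close>. In a merge sequence, a part
  \<open>A\<close> of \<open>P\<^sub>t\<close> must be homogeneous to itself with respect to the order, up to pairs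
  in \<open>R\<^sub>t\<close>. Of two distinct vertices exactly one is the smaller, so a pair within
  \<open>A\<close> violates homogeneity unless it belongs to \<open>R\<^sub>t\<close>: every part is a clique of
  \<open>R\<^sub>t\<close> (\<open>homogeneous_outside_self_imp_clique\<close>; this is where the order is
  indispensable). Now refine the step from \<open>P\<^sub>t\<^sub>-\<^sub>1\<close> to \<open>P\<^sub>t\<close>
  into merges of two parts, in any order (\<open>refines_imp_merges\<close>). If parts \<open>A\<close> and
  \<open>B\<close> of an intermediate partition are not homogeneous, some pair between them is in
  \<open>R\<^sub>t\<close>, so that from any vertex of the clique \<open>A\<close> one reaches \<open>B\<close>
  within two steps, and hits there a part of \<open>P\<^sub>t\<^sub>-\<^sub>1\<close> contained in
  \<open>B\<close>. The radius-2 width therefore bounds the red degree of \<open>A\<close>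
  (\<open>red_degree_le_radius_two\<close>).

  Twin-width bounds merge-width: \<open>merge_width r G \<le> (twin_width G + 1) ^ r + 2\<close>. Along a
  contraction sequence let \<open>R\<^sub>t\<close> consist of the pairs lying in one part of
  \<open>P\<^sub>t\<close> or in two parts joined by a red edge. A path of length \<open>r\<close> in
  \<open>R\<^sub>t\<close> projects to a walk of length at most \<open>r\<close> in the red graph of
  \<open>P\<^sub>t\<close>, and so reaches at most \<open>(d + 1) ^ r\<close> parts of \<open>P\<^sub>t\<close>,
  where \<open>d\<close> bounds the red degree (\<open>card_parts_reachable_le\<close>). Passing to
  \<open>P\<^sub>t\<^sub>-\<^sub>1\<close> changes only two parts.\<close>

section \<open>Partitions and merges of two parts\<close>

lemma partition_on_part_unique:
  assumes "partition_on V P" "A \<in> P" "B \<in> P" "x \<in> A" "x \<in> B"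
  shows "A = B"
  using assms by (auto simp: partition_on_def disjoint_def)

lemma partition_on_part_ex:
  assumes "partition_on V P" "x \<in> V"
  shows "\<exists>A\<in>P. x \<in> A"
  using assms by (auto simp: partition_on_def)

lemma partition_on_part_nonempty:
  assumes "partition_on V P" "A \<in> P"
  shows "\<exists>x. x \<in> A"
  using assms partition_onD3 by (metis ex_in_conv)

lemma partition_on_singletons_sets: "partition_on V (singletons V)"
  unfolding singletons_def by (rule partition_on_singletons)

lemma refines_singletons:
  assumes "partition_on V P"
  shows "refines V (singletons V) P"
  using assms partition_on_singletons_sets[of V] partition_on_part_ex[OF assms]
  unfolding refines_def singletons_def by auto

lemma partition_on_merge:
  assumes "partition_on V P" "A \<in> P" "B \<in> P"
  shows "partition_on V (insert (A \<union> B) (P - {A, B}))"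
proof (rule partition_onI)
  show "\<Union> (insert (A \<union> B) (P - {A, B})) = V"
    using assms by (auto simp: partition_on_def)
  show "{} \<notin> insert (A \<union> B) (P - {A, B})"
    using assms by (auto simp: partition_on_def)
  show "disjnt p q" if "p \<in> insert (A \<union> B) (P - {A, B})" "q \<in> insert (A \<union> B) (P - {A, B})" "p \<noteq> q"
    for p q
    using that partition_on_part_unique[OF assms(1)] assms(2,3)
    unfolding disjnt_iff by blast
qed

lemma merges_two_parts_refines:
  assumes "partition_on V P" "merges_two_parts P Q"
  shows "refines V P Q"
proof -
  obtain A B where AB: "A \<in> P" "B \<in> P" and Q: "Q = insert (A \<union> B) (P - {A, B})"
    using assms(2) unfolding merges_two_parts_def by blast
  have "\<exists>Y\<in>Q. X \<subseteq> Y" if "X \<in> P" for X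
    unfolding Q using that by (cases "X = A \<or> X = B") auto
  then show ?thesis
    using partition_on_merge[OF assms(1) AB] assms(1) Q unfolding refines_def by blast
qed

text \<open>The auxiliary partition \<open>P\<^sub>0\<close> stays fixed while \<open>P\<close> is coarsened step by step, which makes the
  induction also record that all partitions on the way lie between \<open>P\<^sub>0\<close> and \<open>Q\<close>.\<close>

lemma refines_imp_merges:
  assumes "finite V" "refines V P0 P" "refines V P Q"
  shows "(\<lambda>X Y. merges_two_parts X Y \<and> refines V P0 Y \<and> refines V Y Q)\<^sup>*\<^sup>* P Q"
  using assms(2,3)
proof (induction "card P" arbitrary: P rule: less_induct)
  case less
  have pP: "partition_on V P" and pQ: "partition_on V Q"
    using less.prems unfolding refines_def by auto
  have finP: "finite P"
    using finite_elements[OF assms(1) pP] .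
  show ?case
  proof (cases "refines V Q P")
    case True
    then have "P = Q"
      using less.prems(2) by (intro refines_asym)
    then show ?thesis by simp
  next
    case False
    then obtain C where C: "C \<in> Q" "\<And>X. X \<in> P \<Longrightarrow> \<not> C \<subseteq> X"
      using pP pQ unfolding refines_def by blast
    obtain a where a: "a \<in> C"
      using partition_on_part_nonempty[OF pQ C(1)] by blast
    have CV: "C \<subseteq> V"
      using C(1) pQ unfolding partition_on_def by blast
    obtain A where A: "A \<in> P" "a \<in> A"
      using partition_on_part_ex[OF pP] a CV by blast
    obtain b where b: "b \<in> C" "b \<notin> A"
      using C(2)[OF A(1)] by blast
    obtain B where B: "B \<in> P" "b \<in> B"
      using partition_on_part_ex[OF pP] b CV by blast
    have sub: "X \<subseteq> C" if X: "X \<in> P" "x \<in> X" "x \<in> C" for X x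
    proof -
      obtain Y where "Y \<in> Q" "X \<subseteq> Y"
        using X less.prems(2) unfolding refines_def by blast
      then show ?thesis
        using partition_on_part_unique[OF pQ _ C(1), of Y x] X by blast
    qed
    have AC: "A \<subseteq> C" and BC: "B \<subseteq> C"
      using sub A a B b by blast+
    have neq: "A \<noteq> B"
      using b B by blast
    define M where "M = insert (A \<union> B) (P - {A, B})"
    have merge: "merges_two_parts P M"
      unfolding merges_two_parts_def M_def using A B neq by blast
    have PM: "refines V P M"
      using merges_two_parts_refines[OF pP merge] .
    have P0M: "refines V P0 M"
      using refines_trans[OF less.prems(1) PM] .
    have MQ: "refines V M Q"
      using PM pQ less.prems(2) C(1) AC BC unfolding refines_def M_def by blast
    have "card (P - {A, B}) = card P - 2"
      using A B neq finP by (simp add: card_Diff_subset)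
    moreover have "card P \<ge> 2"
      using card_mono[OF finP, of "{A, B}"] A B neq by simp
    ultimately have "card M < card P"
      unfolding M_def using card_insert_le_m1[of "card P - 1" "P - {A, B}" "A \<union> B"] by linarith
    then have "(\<lambda>X Y. merges_two_parts X Y \<and> refines V P0 Y \<and> refines V Y Q)\<^sup>*\<^sup>* M Q"
      using less.hyps[OF _ P0M MQ] by simp
    then show ?thesis
      using merge P0M MQ by (simp add: converse_rtranclp_into_rtranclp)
  qed
qed

lemma rtranclp_imp_successively:
  assumes "(\<lambda>x y. r x y \<and> good y)\<^sup>*\<^sup>* a b" "good a"
  shows "\<exists>xs. xs \<noteq> [] \<and> hd xs = a \<and> last xs = b \<and> successively r xs \<and> (\<forall>x\<in>set xs. good x)"
  using assms(1)
proof (induction rule: rtranclp_induct)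
  case base
  then show ?case
    using assms(2) by (intro exI[of _ "[a]"]) simp
next
  case (step y z)
  then obtain xs where "xs \<noteq> []" "hd xs = a" "last xs = y" "successively r xs" "\<forall>x\<in>set xs. good x"
    by blast
  then show ?case
    using step.hyps(2) by (intro exI[of _ "xs @ [z]"]) (auto simp: successively_append_iff)
qed

section \<open>Witnesses attaining the two widths\<close>

definition width_contraction :: "'a ograph \<Rightarrow> nat \<Rightarrow> 'a set set list \<Rightarrow> bool" where
  "width_contraction G d Ps \<longleftrightarrow>
     contraction_sequence G Ps \<and> (\<forall>P\<in>set Ps. \<forall>A\<in>P. red_degree G P A \<le> d)"

text \<open>A reflexive transitive closure lets chains of merges be composed without handling lists. The
  invariant only has to be checked after each merge, since two singletons are always homogeneous.\<close>

lemma width_contractionI: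
  assumes chain: "(\<lambda>P Q. merges_two_parts P Q \<and>
      (partition_on (verts G) Q \<and> (\<forall>A\<in>Q. red_degree G Q A \<le> d)))\<^sup>*\<^sup>* (singletons (verts G)) Q"
    and one: "card Q \<le> 1"
  shows "\<exists>Ps. width_contraction G d Ps"
proof -
  have hom: "homogeneous G {a} {b}" for a b
    unfolding homogeneous_def by auto
  have "red_degree G (singletons (verts G)) A = 0" if "A \<in> singletons (verts G)" for A
  proof -
    have "{B \<in> singletons (verts G). B \<noteq> A \<and> \<not> homogeneous G A B} = {}"
      using that hom unfolding singletons_def by blast
    then show ?thesis
      unfolding red_degree_def by (simp only: card.empty)
  qed
  then have good: "partition_on (verts G) (singletons (verts G)) \<and>
      (\<forall>A\<in>singletons (verts G). red_degree G (singletons (verts G)) A \<le> d)"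
    using partition_on_singletons_sets by auto
  from rtranclp_imp_successively[OF chain good] one show ?thesis
    unfolding width_contraction_def contraction_sequence_def by blast
qed

lemma twin_width_eq_Least: "twin_width G = (LEAST d. \<exists>Ps. width_contraction G d Ps)"
  unfolding twin_width_def width_contraction_def ..

lemma twin_width_le:
  assumes "width_contraction G d Ps"
  shows "twin_width G \<le> d"
  unfolding twin_width_eq_Least using assms by (intro Least_le) blast

text \<open>Merging the parts in any order down to a single one gives some contraction sequence, so the
  minimum defining the twin-width is taken over a nonempty set.\<close>

lemma twin_width_attained:
  assumes fin: "finite (verts G)"
  obtains Ps where "width_contraction G (twin_width G) Ps"
proof -
  let ?V = "verts G"
  define Q where "Q = {?V} - {{}}"
  define d where "d = card (Pow ?V)"
  have pQ: "partition_on ?V Q"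
    unfolding Q_def partition_on_def by (auto simp: disjoint_def)
  have "card Q \<le> 1"
    unfolding Q_def using card_mono[of "{?V}" "{?V} - {{}}"] by simp
  moreover have red: "red_degree G P A \<le> d" if "partition_on ?V P" for P A
    unfolding red_degree_def d_def using that fin
    by (intro card_mono) (auto simp: partition_on_def)
  have "(\<lambda>X Y. merges_two_parts X Y \<and> refines ?V (singletons ?V) Y \<and> refines ?V Y Q)\<^sup>*\<^sup>*
      (singletons ?V) Q"
    using refines_imp_merges[OF fin refines_refl refines_singletons[OF pQ]]
      partition_on_singletons_sets by blast
  then have "(\<lambda>P Q. merges_two_parts P Q \<and>
      (partition_on ?V Q \<and> (\<forall>A\<in>Q. red_degree G Q A \<le> d)))\<^sup>*\<^sup>* (singletons ?V) Q"
    by (rule rtranclp_mono[THEN predicate2D, rotated]) (auto simp: refines_def red)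
  ultimately have "\<exists>d Ps. width_contraction G d Ps"
    using width_contractionI by blast
  then have "\<exists>Ps. width_contraction G (twin_width G) Ps"
    unfolding twin_width_eq_Least by (rule LeastI_ex)
  then show ?thesis
    using that by blast
qed

lemma card_le_merge_sequence_width:
  assumes "finite (verts G)" "1 \<le> t" "t < length ms" "v \<in> verts G"
  shows "card {A \<in> fst (ms ! (t - 1)). \<exists>w\<in>A. reachable_within (snd (ms ! t)) r v w}
    \<le> merge_sequence_width r G ms"
proof -
  let ?f = "\<lambda>(t, v). card {A \<in> fst (ms ! (t - 1)). \<exists>w\<in>A. reachable_within (snd (ms ! t)) r v w}"
  have "bdd_above (?f ` ({1..<length ms} \<times> verts G))"
    using assms(1) by (intro bdd_above_finite) simp
  then have "?f (t, v) \<le> (SUP p \<in> {1..<length ms} \<times> verts G. ?f p)"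
    using assms by (intro cSUP_upper) auto
  then show ?thesis
    unfolding merge_sequence_width_def by simp
qed

lemma merge_sequence_width_le:
  assumes "\<And>t v. 1 \<le> t \<Longrightarrow> t < length ms \<Longrightarrow> v \<in> verts G \<Longrightarrow>
    card {A \<in> fst (ms ! (t - 1)). \<exists>w\<in>A. reachable_within (snd (ms ! t)) r v w} \<le> k"
  shows "merge_sequence_width r G ms \<le> k"
proof (cases "{1..<length ms} \<times> verts G = {}")
  case True
  \<comment> \<open>The supremum of the empty set of natural numbers is \<open>0\<close>.\<close>
  then show ?thesis
    unfolding merge_sequence_width_def by (simp only: True image_empty) (simp add: Sup_nat_def)
next
  case False
  then show ?thesis
    unfolding merge_sequence_width_def using assms by (intro cSUP_least) auto
qed

section \<open>Merge-width bounds twin-width\<close>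

text \<open>Taking both arguments of homogeneity to be the same part puts \<open>(a, b)\<close> and \<open>(b, a)\<close> under one
  alternative, which a strict linear order cannot satisfy.\<close>

lemma homogeneous_outside_self_imp_clique:
  assumes "ordered_graph G" "A \<subseteq> verts G" "homogeneous_outside G R A A" "a \<in> A" "b \<in> A" "a \<noteq> b"
  shows "{a, b} \<in> R"
proof (rule ccontr)
  assume notR: "{a, b} \<notin> R"
  then have "{b, a} \<notin> R"
    by (simp add: insert_commute)
  then have "(a, b) \<in> lt G \<longleftrightarrow> (b, a) \<in> lt G"
    using assms(3-6) notR unfolding homogeneous_outside_def by auto
  moreover have "trans (lt G)" "irrefl (lt G)" "(a, b) \<in> lt G \<or> (b, a) \<in> lt G"
    using assms unfolding ordered_graph_def strict_linear_order_on_def total_on_def by blast+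
  ultimately show False
    by (meson irreflD transD)
qed

lemma not_homogeneous_imp_crossing_pair:
  assumes "homogeneous_outside G R A' B'" "A \<subseteq> A'" "B \<subseteq> B'" "A \<inter> B = {}" "\<not> homogeneous G A B"
  shows "\<exists>a\<in>A. \<exists>b\<in>B. {a, b} \<in> R"
proof (rule ccontr)
  assume "\<not> ?thesis"
  then have *: "a \<noteq> b \<and> {a, b} \<notin> R" if "a \<in> A" "b \<in> B" for a b
    using that assms(4) by blast
  have "homogeneous G A B"
    unfolding homogeneous_def
  proof
    fix S assume "S \<in> {edges G, lt G}"
    then have "(\<forall>a\<in>A'. \<forall>b\<in>B'. a \<noteq> b \<and> {a, b} \<notin> R \<longrightarrow> (a, b) \<in> S) \<or>
        (\<forall>a\<in>A'. \<forall>b\<in>B'. a \<noteq> b \<and> {a, b} \<notin> R \<longrightarrow> (a, b) \<notin> S)"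
      using assms(1) unfolding homogeneous_outside_def by blast
    then show "(\<forall>a\<in>A. \<forall>b\<in>B. (a, b) \<in> S) \<or> (\<forall>a\<in>A. \<forall>b\<in>B. (a, b) \<notin> S)"
      using * assms(2,3) by (meson subsetD)
  qed
  with assms(5) show False ..
qed

text \<open>A red neighbour \<open>B\<close> of \<open>A\<close> is reached by first moving inside the clique \<open>A\<close> and then crossing to
  \<open>B\<close>. Distinct red neighbours contain distinct parts of the finer partition \<open>P\<close>.\<close>

lemma red_degree_le_radius_two:
  assumes og: "ordered_graph G"
    and PQ: "refines (verts G) P Q" and QP': "refines (verts G) Q P'"
    and hom: "\<forall>A\<in>P'. \<forall>B\<in>P'. homogeneous_outside G R A B"
    and A: "A \<in> Q" and v: "v \<in> A"
  shows "red_degree G Q A \<le> card {X \<in> P. \<exists>w\<in>X. reachable_within R 2 v w}"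
proof -
  let ?S = "{X \<in> P. \<exists>w\<in>X. reachable_within R 2 v w}"
  let ?N = "{B \<in> Q. B \<noteq> A \<and> \<not> homogeneous G A B}"
  have pP: "partition_on (verts G) P" and pQ: "partition_on (verts G) Q"
    and pP': "partition_on (verts G) P'"
    using PQ QP' unfolding refines_def by auto
  have fin: "finite (verts G)"
    using og unfolding ordered_graph_def by blast
  have coarse: "\<exists>A'\<in>P'. X \<subseteq> A'" if "X \<in> Q" for X
    using that QP' unfolding refines_def by blast
  obtain A' where A': "A' \<in> P'" "A \<subseteq> A'"
    using coarse[OF A] by blast
  have "\<forall>B\<in>?N. \<exists>X. X \<in> ?S \<and> X \<subseteq> B"
  proof
    fix B assume "B \<in> ?N"
    then have B: "B \<in> Q" "B \<noteq> A" "\<not> homogeneous G A B"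
      by auto
    obtain B' where B': "B' \<in> P'" "B \<subseteq> B'"
      using coarse[OF B(1)] by blast
    have disj: "A \<inter> B = {}"
      using partition_on_part_unique[OF pQ A B(1)] B(2) by blast
    obtain a b where ab: "a \<in> A" "b \<in> B" "{a, b} \<in> R"
      using not_homogeneous_imp_crossing_pair[OF _ A'(2) B'(2) disj B(3)] hom A' B' by blast
    have "b \<in> verts G"
      using ab(2) B(1) pQ unfolding partition_on_def by blast
    then obtain X where X: "X \<in> P" "b \<in> X"
      using partition_on_part_ex[OF pP] by blast
    obtain Y where "Y \<in> Q" "X \<subseteq> Y"
      using X(1) PQ unfolding refines_def by blast
    then have "X \<subseteq> B"
      using partition_on_part_unique[OF pQ _ B(1), of Y b] X(2) ab(2) by blast
    moreover have "reachable_within R 2 v b"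
    proof (cases "a = v")
      case True
      then have "path_between R v [v, b] b"
        unfolding path_between_def using ab disj by auto
      then show ?thesis
        unfolding reachable_within_def by (intro exI[of _ "[v, b]"]) simp
    next
      case False
      have "A' \<subseteq> verts G"
        using A'(1) pP' unfolding partition_on_def by blast
      moreover have "homogeneous_outside G R A' A'" "v \<in> A'" "a \<in> A'" "v \<noteq> a"
        using hom A' v ab(1) False by auto
      ultimately have "{v, a} \<in> R"
        by (rule homogeneous_outside_self_imp_clique[OF og])
      moreover have "b \<noteq> v" "b \<noteq> a"
        using v ab(1,2) disj by auto
      ultimately have "path_between R v [v, a, b] b"
        unfolding path_between_def using ab(3) False by simp
      then show ?thesis
        unfolding reachable_within_def by (intro exI[of _ "[v, a, b]"]) simp
    qed
    ultimately show "\<exists>X. X \<in> ?S \<and> X \<subseteq> B"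
      using X by blast
  qed
  from bchoice[OF this] obtain f where f: "\<forall>B\<in>?N. f B \<in> ?S \<and> f B \<subseteq> B"
    by (elim exE)
  have "inj_on f ?N"
  proof (rule inj_onI)
    fix B C assume BC: "B \<in> ?N" "C \<in> ?N" "f B = f C"
    have "f B \<in> P" "f B \<subseteq> B" "f B \<subseteq> C"
      using bspec[OF f BC(1)] bspec[OF f BC(2)] BC(3) by auto
    moreover from this obtain x where "x \<in> f B"
      using partition_on_part_nonempty[OF pP] by blast
    ultimately show "B = C"
      using partition_on_part_unique[OF pQ, of B C x] BC by blast
  qed
  moreover have "f ` ?N \<subseteq> ?S"
    using f by blast
  moreover have "finite ?S"
    using finite_elements[OF fin pP] by simp
  ultimately show ?thesis
    unfolding red_degree_def by (rule card_inj_on_le)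
qed

lemma merge_sequence_nth:
  assumes "merge_sequence G ms" "t < length ms"
  shows "partition_on (verts G) (fst (ms ! t))"
    and "\<forall>A\<in>fst (ms ! t). \<forall>B\<in>fst (ms ! t). homogeneous_outside G (snd (ms ! t)) A B"
  using assms nth_mem[OF assms(2)] unfolding merge_sequence_def by (auto simp: case_prod_beta)

lemma twin_width_le_merge_sequence_width:
  assumes og: "ordered_graph G" and ms: "merge_sequence G ms"
  shows "twin_width G \<le> merge_sequence_width 2 G ms"
proof -
  let ?V = "verts G" and ?d = "merge_sequence_width 2 G ms"
  let ?step = "\<lambda>P Q. merges_two_parts P Q \<and>
      (partition_on ?V Q \<and> (\<forall>A\<in>Q. red_degree G Q A \<le> ?d))"
  have fin: "finite ?V"
    using og unfolding ordered_graph_def by blast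
  have ne: "ms \<noteq> []"
    using ms unfolding merge_sequence_def by blast
  have chain: "?step\<^sup>*\<^sup>* (singletons ?V) (fst (ms ! t))" if "t < length ms" for t
    using that
  proof (induction t)
    case 0
    have "fst (ms ! 0) = singletons ?V"
      using ms hd_conv_nth[OF ne] unfolding merge_sequence_def by simp
    then show ?case by simp
  next
    case (Suc t)
    have ref: "refines ?V (fst (ms ! t)) (fst (ms ! Suc t))"
      using ms Suc.prems unfolding merge_sequence_def
      by (auto simp: successively_conv_nth case_prod_beta)
    have red: "red_degree G Q A \<le> ?d"
      if Q: "refines ?V (fst (ms ! t)) Q" "refines ?V Q (fst (ms ! Suc t))" and A: "A \<in> Q" for Q A
    proof -
      have pQ: "partition_on ?V Q"
        using Q unfolding refines_def by blast
      then obtain v where v: "v \<in> A"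
        using partition_on_part_nonempty A by blast
      then have vV: "v \<in> ?V"
        using A pQ unfolding partition_on_def by blast
      have "red_degree G Q A
          \<le> card {X \<in> fst (ms ! t). \<exists>w\<in>X. reachable_within (snd (ms ! Suc t)) 2 v w}"
        using red_degree_le_radius_two[OF og Q merge_sequence_nth(2)[OF ms Suc.prems] A v] .
      also have "\<dots> \<le> ?d"
        using card_le_merge_sequence_width[OF fin _ Suc.prems vV, of 2] by simp
      finally show ?thesis .
    qed
    have "(\<lambda>X Y. merges_two_parts X Y \<and> refines ?V (fst (ms ! t)) Y \<and>
        refines ?V Y (fst (ms ! Suc t)))\<^sup>*\<^sup>* (fst (ms ! t)) (fst (ms ! Suc t))"
      using refines_imp_merges[OF fin refines_refl ref] merge_sequence_nth(1)[OF ms] Suc.prems by simp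
    then have "?step\<^sup>*\<^sup>* (fst (ms ! t)) (fst (ms ! Suc t))"
      by (rule rtranclp_mono[THEN predicate2D, rotated]) (auto simp: red, auto simp: refines_def)
    with Suc.IH Suc.prems show ?case
      by simp
  qed
  have "card (fst (ms ! (length ms - 1))) \<le> 1"
    using ms ne unfolding merge_sequence_def by (simp add: last_conv_nth)
  moreover have "?step\<^sup>*\<^sup>* (singletons ?V) (fst (ms ! (length ms - 1)))"
    using chain ne by simp
  ultimately obtain Ps where "width_contraction G ?d Ps"
    using width_contractionI by blast
  then show ?thesis
    by (rule twin_width_le)
qed

section \<open>Twin-width bounds merge-width\<close>

definition red_pairs :: "'a ograph \<Rightarrow> 'a set set \<Rightarrow> 'a set set" where
  "red_pairs G P =
     {{a, b} |a b A B. A \<in> P \<and> B \<in> P \<and> a \<in> A \<and> b \<in> B \<and> a \<noteq> b \<and> (A = B \<or> \<not> homogeneous G A B)}"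

lemma homogeneous_commute:
  assumes og: "ordered_graph G" and sub: "A \<subseteq> verts G" "B \<subseteq> verts G" and disj: "A \<inter> B = {}"
    and hom: "homogeneous G A B"
  shows "homogeneous G B A"
proof -
  have e: "(b, a) \<in> edges G \<longleftrightarrow> (a, b) \<in> edges G" for a b
    using og unfolding ordered_graph_def by (meson symD)
  \<comment> \<open>For the order, the two alternatives of homogeneity are exchanged.\<close>
  have l: "(b, a) \<in> lt G \<longleftrightarrow> (a, b) \<notin> lt G" if ab: "a \<in> A" "b \<in> B" for a b
  proof -
    have "trans (lt G)" "irrefl (lt G)" "total_on (verts G) (lt G)"
      using og unfolding ordered_graph_def strict_linear_order_on_def by auto
    moreover have "a \<noteq> b" "a \<in> verts G" "b \<in> verts G"
      using ab sub disj by auto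
    ultimately show ?thesis
      by (meson irreflD total_on_def transD)
  qed
  have "(\<forall>a\<in>A. \<forall>b\<in>B. (a, b) \<in> edges G) \<or> (\<forall>a\<in>A. \<forall>b\<in>B. (a, b) \<notin> edges G)"
    using hom unfolding homogeneous_def by simp
  then have "(\<forall>b\<in>B. \<forall>a\<in>A. (b, a) \<in> edges G) \<or> (\<forall>b\<in>B. \<forall>a\<in>A. (b, a) \<notin> edges G)"
    using e by blast
  moreover have "(\<forall>a\<in>A. \<forall>b\<in>B. (a, b) \<in> lt G) \<or> (\<forall>a\<in>A. \<forall>b\<in>B. (a, b) \<notin> lt G)"
    using hom unfolding homogeneous_def by simp
  then have "(\<forall>b\<in>B. \<forall>a\<in>A. (b, a) \<in> lt G) \<or> (\<forall>b\<in>B. \<forall>a\<in>A. (b, a) \<notin> lt G)"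
    using l by simp blast
  ultimately show ?thesis
    unfolding homogeneous_def by simp
qed

lemma red_pairs_subset_nsets:
  assumes "partition_on V P"
  shows "red_pairs G P \<subseteq> nsets V 2"
proof -
  have "x \<in> V" if "x \<in> A" "A \<in> P" for x A
    using assms that unfolding partition_on_def by blast
  then show ?thesis
    unfolding red_pairs_def by auto
qed

text \<open>Merging parts destroys homogeneity but never creates it.\<close>

lemma red_pairs_mono:
  assumes "refines V P Q"
  shows "red_pairs G P \<subseteq> red_pairs G Q"
proof
  fix e assume "e \<in> red_pairs G P"
  then obtain a b A B where e: "e = {a, b}" "A \<in> P" "B \<in> P" "a \<in> A" "b \<in> B" "a \<noteq> b"
    "A = B \<or> \<not> homogeneous G A B"
    unfolding red_pairs_def by blast
  then obtain A' B' where AB': "A' \<in> Q" "A \<subseteq> A'" "B' \<in> Q" "B \<subseteq> B'"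
    using assms unfolding refines_def by metis
  have "A' = B'" if "A = B"
    using that e AB' assms partition_on_part_unique[of V Q A' B' a] unfolding refines_def by blast
  moreover have "\<not> homogeneous G A' B'" if "\<not> homogeneous G A B"
    using that AB' unfolding homogeneous_def by blast
  ultimately show "e \<in> red_pairs G Q"
    unfolding red_pairs_def using e AB' by blast
qed

lemma homogeneous_outside_red_pairs:
  assumes "A \<in> P" "B \<in> P"
  shows "homogeneous_outside G (red_pairs G P) A B"
proof (cases "A = B \<or> \<not> homogeneous G A B")
  case True
  then have "{a, b} \<in> red_pairs G P" if "a \<in> A" "b \<in> B" "a \<noteq> b" for a b
    unfolding red_pairs_def using assms that by blast
  then show ?thesis
    unfolding homogeneous_outside_def by blast
next
  case False
  then show ?thesis
    unfolding homogeneous_def homogeneous_outside_def by blast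
qed

text \<open>The edge \<open>{u, w}\<close> has no direction whereas \<open>homogeneous\<close> has one, hence the use of its
  symmetry.\<close>

lemma red_pairs_neighbour_parts:
  assumes og: "ordered_graph G" and part: "partition_on (verts G) P"
    and uw: "{u, w} \<in> red_pairs G P" "u \<in> A" "A \<in> P" "w \<in> B" "B \<in> P"
  shows "B = A \<or> \<not> homogeneous G A B"
proof -
  obtain a b X Y where e: "{u, w} = {a, b}" "X \<in> P" "Y \<in> P" "a \<in> X" "b \<in> Y"
    "X = Y \<or> \<not> homogeneous G X Y"
    using uw(1) unfolding red_pairs_def by blast
  note un = partition_on_part_unique[OF part]
  from e(1) consider "u = a" "w = b" | "u = b" "w = a"
    by (auto simp: doubleton_eq_iff)
  then show ?thesis
  proof cases
    case 1
    then have "A = X" "B = Y"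
      using un[OF uw(3) e(2) uw(2)] un[OF uw(5) e(3) uw(4)] e(4,5) by simp_all
    then show ?thesis
      using e by blast
  next
    case 2
    then have AB: "A = Y" "B = X"
      using un[OF uw(3) e(3) uw(2)] un[OF uw(5) e(2) uw(4)] e(4,5) by simp_all
    have "A \<subseteq> verts G" "B \<subseteq> verts G"
      using uw part unfolding partition_on_def by blast+
    moreover have "A \<inter> B = {}" if "A \<noteq> B"
      using that un[OF uw(3,5)] by blast
    ultimately show ?thesis
      using homogeneous_commute[OF og] e(6) AB by blast
  qed
qed

lemma reachable_within_0: "reachable_within R 0 v w \<Longrightarrow> w = v"
  unfolding reachable_within_def path_between_def by (auto simp: length_Suc_conv le_Suc_eq)

lemma reachable_within_Suc:
  assumes "reachable_within R (Suc r) v w"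
  shows "\<exists>u. reachable_within R r v u \<and> (u = w \<or> {u, w} \<in> R)"
proof -
  obtain p where p: "path_between R v p w" "length p - 1 \<le> Suc r"
    using assms unfolding reachable_within_def by blast
  show ?thesis
  proof (cases "length p - 1 \<le> r")
    case True
    then show ?thesis
      using p unfolding reachable_within_def by blast
  next
    case False
    obtain q where q: "p = q @ [w]"
      using p(1) unfolding path_between_def by (metis append_butlast_last_id)
    have qne: "q \<noteq> []"
      using False q by auto
    have "path_between R v q (last q)" "{last q, w} \<in> R"
      using p(1) qne unfolding path_between_def q by (auto simp: successively_append_iff)
    moreover have "length q - 1 \<le> r"
      using p(2) q by simp
    ultimately show ?thesis
      unfolding reachable_within_def by blast
  qed
qed

text \<open>Each further step of a path stays in the current part or moves to one of its at most \<open>d\<close> red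
  neighbours.\<close>

lemma card_parts_reachable_le:
  assumes og: "ordered_graph G" and part: "partition_on (verts G) P"
    and deg: "\<forall>A\<in>P. red_degree G P A \<le> d" and v: "v \<in> verts G"
  shows "card {A \<in> P. \<exists>w\<in>A. reachable_within (red_pairs G P) r v w} \<le> (d + 1) ^ r"
proof (induction r)
  case 0
  obtain A where A: "A \<in> P" "v \<in> A"
    using partition_on_part_ex[OF part v] by blast
  then have "{A \<in> P. \<exists>w\<in>A. reachable_within (red_pairs G P) 0 v w} \<subseteq> {A}"
    using partition_on_part_unique[OF part] reachable_within_0 by fastforce
  then show ?case
    using card_mono[of "{A}"] by simp
next
  case (Suc r)
  let ?S = "\<lambda>r. {A \<in> P. \<exists>w\<in>A. reachable_within (red_pairs G P) r v w}"
  let ?N = "\<lambda>A. insert A {B \<in> P. B \<noteq> A \<and> \<not> homogeneous G A B}"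
  have finP: "finite P"
    using og part finite_elements unfolding ordered_graph_def by blast
  have "?S (Suc r) \<subseteq> (\<Union>A\<in>?S r. ?N A)"
  proof
    fix B assume "B \<in> ?S (Suc r)"
    then obtain w where B: "B \<in> P" "w \<in> B" and reach: "reachable_within (red_pairs G P) (Suc r) v w"
      by blast
    obtain u where u: "reachable_within (red_pairs G P) r v u" "u = w \<or> {u, w} \<in> red_pairs G P"
      using reachable_within_Suc[OF reach] by blast
    have "w \<in> verts G"
      using B part unfolding partition_on_def by blast
    then have "u \<in> verts G"
      using u(2) red_pairs_subset_nsets[OF part, of G] by auto
    then obtain A where A: "A \<in> P" "u \<in> A"
      using partition_on_part_ex[OF part] by blast
    have "B = A \<or> \<not> homogeneous G A B"
      using u(2) red_pairs_neighbour_parts[OF og part _ A(2,1) B(2,1)]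
        partition_on_part_unique[OF part A(1) B(1), of u] A B by blast
    then show "B \<in> (\<Union>A\<in>?S r. ?N A)"
      using A B u(1) by blast
  qed
  then have "card (?S (Suc r)) \<le> card (\<Union>A\<in>?S r. ?N A)"
    using finP by (intro card_mono) auto
  also have "\<dots> \<le> (\<Sum>A\<in>?S r. card (?N A))"
    using finP by (intro card_UN_le) simp
  also have "\<dots> \<le> (\<Sum>A\<in>?S r. d + 1)"
  proof (rule sum_mono)
    fix A assume "A \<in> ?S r"
    then have "card {B \<in> P. B \<noteq> A \<and> \<not> homogeneous G A B} \<le> d"
      using deg unfolding red_degree_def by blast
    then show "card (?N A) \<le> d + 1"
      using finP by simp
  qed
  also have "\<dots> = card (?S r) * (d + 1)"
    by simp
  also have "\<dots> \<le> (d + 1) ^ r * (d + 1)"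
    using Suc.IH by (rule mult_right_mono) simp
  finally show ?case
    by (simp add: mult.commute)
qed

definition red_merge_sequence :: "'a ograph \<Rightarrow> 'a set set list \<Rightarrow> ('a set set \<times> 'a set set) list" where
  "red_merge_sequence G Ps = map (\<lambda>P. (P, red_pairs G P)) Ps"

lemma merge_sequence_red_merge_sequence:
  assumes "contraction_sequence G Ps"
  shows "merge_sequence G (red_merge_sequence G Ps)"
proof -
  have Ps: "Ps \<noteq> []" "\<forall>P\<in>set Ps. partition_on (verts G) P" "hd Ps = singletons (verts G)"
    "card (last Ps) \<le> 1" "successively merges_two_parts Ps"
    using assms unfolding contraction_sequence_def by auto
  have "successively (\<lambda>P Q. refines (verts G) P Q \<and> red_pairs G P \<subseteq> red_pairs G Q) Ps"
    using Ps(5)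
  proof (rule successively_mono)
    fix P Q assume "P \<in> set Ps" "merges_two_parts P Q"
    then have "refines (verts G) P Q"
      using merges_two_parts_refines Ps(2) by blast
    then show "refines (verts G) P Q \<and> red_pairs G P \<subseteq> red_pairs G Q"
      using red_pairs_mono by blast
  qed
  moreover have "red_pairs G P \<subseteq> nsets (verts G) 2" if "P \<in> set Ps" for P
    using red_pairs_subset_nsets Ps(2) that by blast
  ultimately show ?thesis
    using Ps homogeneous_outside_red_pairs[of _ _ _ G]
    unfolding merge_sequence_def red_merge_sequence_def
    by (simp add: successively_map hd_map last_map)
qed

text \<open>Paths are counted in the coarser partition \<open>Q\<close>, to which they are adapted. The finer \<open>P\<close> has at
  most the two merged parts in addition, which accounts for the summand \<open>2\<close>.\<close>

lemma red_merge_sequence_width_le: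
  assumes og: "ordered_graph G" and Ps: "width_contraction G d Ps"
  shows "merge_sequence_width r G (red_merge_sequence G Ps) \<le> (d + 1) ^ r + 2"
proof (rule merge_sequence_width_le)
  fix t v
  assume t: "1 \<le> t" "t < length (red_merge_sequence G Ps)" and v: "v \<in> verts G"
  define P Q where "P = Ps ! (t - 1)" and "Q = Ps ! t"
  let ?R = "red_pairs G Q"
  let ?S = "\<lambda>P. {A \<in> P. \<exists>w\<in>A. reachable_within ?R r v w}"
  have tl: "t < length Ps"
    using t unfolding red_merge_sequence_def by simp
  then have Qin: "Q \<in> set Ps"
    unfolding Q_def by simp
  have "merges_two_parts P Q"
    using Ps t(1) tl successively_nth[of merges_two_parts Ps "t - 1"]
    unfolding width_contraction_def contraction_sequence_def P_def Q_def by simp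
  then obtain A B where Q: "Q = insert (A \<union> B) (P - {A, B})"
    unfolding merges_two_parts_def by blast
  have part: "partition_on (verts G) Q" and deg: "\<forall>A\<in>Q. red_degree G Q A \<le> d"
    using Ps Qin unfolding width_contraction_def contraction_sequence_def by auto
  have finQ: "finite Q"
    using og part finite_elements unfolding ordered_graph_def by blast
  have "?S P \<subseteq> ?S Q \<union> {A, B}"
    unfolding Q by blast
  then have "card (?S P) \<le> card (?S Q \<union> {A, B})"
    using finQ by (intro card_mono) auto
  also have "\<dots> \<le> card (?S Q) + card {A, B}"
    by (rule card_Un_le)
  also have "\<dots> \<le> (d + 1) ^ r + 2"
    using card_parts_reachable_le[OF og part deg v, of r] card_insert_le_m1[of 2 "{B}" A]
    by (intro add_mono) auto
  finally show "card {A \<in> fst (red_merge_sequence G Ps ! (t - 1)).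
      \<exists>w\<in>A. reachable_within (snd (red_merge_sequence G Ps ! t)) r v w} \<le> (d + 1) ^ r + 2"
    using tl unfolding red_merge_sequence_def P_def Q_def by simp
qed

section \<open>The two parameters compared\<close>

lemma merge_width_le_twin_width:
  assumes og: "ordered_graph G"
  shows "merge_width r G \<le> (twin_width G + 1) ^ r + 2"
proof -
  obtain Ps where Ps: "width_contraction G (twin_width G) Ps"
    using og twin_width_attained unfolding ordered_graph_def by blast
  let ?ms = "red_merge_sequence G Ps"
  have "merge_sequence G ?ms"
    using Ps merge_sequence_red_merge_sequence unfolding width_contraction_def by blast
  then have "merge_width r G \<le> merge_sequence_width r G ?ms"
    unfolding merge_width_def by (intro Least_le) blast
  also have "\<dots> \<le> (twin_width G + 1) ^ r + 2"
    using red_merge_sequence_width_le[OF og Ps] .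
  finally show ?thesis .
qed

lemma twin_width_le_merge_width_two:
  assumes og: "ordered_graph G"
  shows "twin_width G \<le> merge_width 2 G"
proof -
  obtain Ps where "width_contraction G (twin_width G) Ps"
    using og twin_width_attained unfolding ordered_graph_def by blast
  then have "\<exists>ms. merge_sequence G ms"
    using merge_sequence_red_merge_sequence unfolding width_contraction_def by blast
  then have "\<exists>k ms. merge_sequence G ms \<and> merge_sequence_width 2 G ms = k"
    by blast
  then have "\<exists>ms. merge_sequence G ms \<and> merge_sequence_width 2 G ms = merge_width 2 G"
    unfolding merge_width_def by (rule LeastI_ex)
  then show ?thesis
    using twin_width_le_merge_sequence_width[OF og] by metis
qed

theorem corollary1p9:
  fixes C :: "'a ograph set"
  assumes "\<forall>G \<in> C. ordered_graph G"
  shows "bounded_twin_width C \<longleftrightarrow> bounded_merge_width C"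
proof
  assume "bounded_twin_width C"
  then obtain c where c: "\<forall>G\<in>C. twin_width G \<le> c"
    unfolding bounded_twin_width_def by blast
  have "merge_width r G \<le> (c + 1) ^ r + 2" if "G \<in> C" for r G
  proof -
    have "merge_width r G \<le> (twin_width G + 1) ^ r + 2"
      using merge_width_le_twin_width assms that by blast
    also have "\<dots> \<le> (c + 1) ^ r + 2"
      using c that by (intro add_mono power_mono) auto
    finally show ?thesis .
  qed
  then show "bounded_merge_width C"
    unfolding bounded_merge_width_def by blast
next
  assume "bounded_merge_width C"
  then obtain c where "\<forall>G\<in>C. merge_width 2 G \<le> c"
    unfolding bounded_merge_width_def by blast
  then show "bounded_twin_width C"
    unfolding bounded_twin_width_def
    using twin_width_le_merge_width_two assms order_trans by blast
qed

end
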